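(* Let $w \in \mathbb{N}^*$. Then the words in the $\equiv_{\mathrm{mSt}}$-class $[w]_{\mathrm{mSt}}$ of $w$ are in bijection with the linear extensions of the poset $P[X;\tau]$, where $k = |\mathrm{supp}(w)|$ and, for $1 \leq i \leq k$, $X_i = |w|_{\overrightarrow{\rho_w}^{-1}(i)}$ and $\tau_i = \overrightarrow{\rho_w}\bigl(\overleftarrow{\rho_w}^{-1}(i)\bigr)$.
   Context: $\mathbb{N}=\{1,2,\dots\}$ and $\mathbb{N}^*$ is the set of words over $\mathbb{N}$. $|w|_x$ is the number of occurrences of the letter $x$ in $w$ and $\mathrm{supp}(w)$ is the set of letters occurring in $w$. $\overrightarrow{\rho_w}$ (resp. $\overleftarrow{\rho_w}$) is the bijection $\mathrm{supp}(w)\to\{1,\dots,|\mathrm{supp}(w)|\}$ sending a letter to its rank when the letters of $w$ are ordered by the position of their first (resp. last) occurrence, reading $w$ from left to right. The meet-stalactic congruence $\equiv_{\mathrm{mSt}}$ on $\mathbb{N}^*$ is given by: $u\equiv_{\mathrm{mSt}}v$ iff $|u|_x=|v|_x$ for every letter $x$, $\overrightarrow{\rho_u}=\overrightarrow{\rho_v}$ and $\overleftarrow{\rho_u}=\overleftarrow{\rho_v}$. For $k\in\mathbb{N}$, $X=(X_1,\dots,X_k)\in\mathbb{N}^k$ and a permutation $\tau$ of $\{1,\dots,k\}$ (with $\tau_i$ the image of $i$), $P[X;\tau]$ is the poset built by taking $k$ disjoint chains, the $i$-th having $X_i$ elements, and requiring, for $1\le i<k$, the least element of the $i$-th chain to be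 less than the least element of the $(i+1)$-th chain, and the greatest element of the $\tau_i$-th chain to be less than the greatest element of the $\tau_{i+1}$-th chain (the order being generated by these relations). A linear extension of a poset is a total order on the same underlying set containing the given partial order. *)

theory Defs
  imports Main "HOL-Library.FuncSet"
begin

definition words :: "nat list set" where
  "words = lists {1..}"

definition first_pos :: "nat list \<Rightarrow> nat \<Rightarrow> nat" where
  "first_pos w x = (LEAST i. i < length w \<and> w ! i = x)"

definition last_pos :: "nat list \<Rightarrow> nat \<Rightarrow> nat" where
  "last_pos w x = (GREATEST i. i < length w \<and> w ! i = x)"

text \<open>The support of \<open>w\<close> is \<open>set w\<close>. The two rank functions are maps with domain \<open>set w\<close>,
  encoded as extensional functions; ranks start at 1.\<close>

definition first_rank :: "nat list \<Rightarrow> nat \<Rightarrow> nat" where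
  "first_rank w = (\<lambda>x\<in>set w. card {y \<in> set w. first_pos w y \<le> first_pos w x})"

definition last_rank :: "nat list \<Rightarrow> nat \<Rightarrow> nat" where
  "last_rank w = (\<lambda>x\<in>set w. card {y \<in> set w. last_pos w y \<le> last_pos w x})"

text \<open>Equality of the rank functions below is equality of maps on the common support: the
  condition on the letter counts already forces \<open>set u = set v\<close>.\<close>

definition mSt_cong :: "nat list \<Rightarrow> nat list \<Rightarrow> bool" where
  "mSt_cong u v \<longleftrightarrow> (\<forall>x. count_list u x = count_list v x)
     \<and> first_rank u = first_rank v \<and> last_rank u = last_rank v"

definition mSt_class :: "nat list \<Rightarrow> nat list set" where
  "mSt_class w = {v \<in> words. mSt_cong w v}"

text \<open>The pair \<open>(i, j)\<close> is the \<open>j\<close>-th smallest element of the \<open>i\<close>-th chain. Only the values of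
  \<open>X\<close> and \<open>\<tau>\<close> on \<open>{1..k}\<close> matter.\<close>

definition chain_elems :: "nat \<Rightarrow> (nat \<Rightarrow> nat) \<Rightarrow> (nat \<times> nat) set" where
  "chain_elems k X = (SIGMA i:{1..k}. {1..X i})"

text \<open>The first set of generators contains the diagonal of \<open>chain_elems k X\<close>, so the transitive
  closure is also reflexive there.\<close>

definition chain_order :: "nat \<Rightarrow> (nat \<Rightarrow> nat) \<Rightarrow> (nat \<Rightarrow> nat) \<Rightarrow> (nat \<times> nat) rel" where
  "chain_order k X \<tau> =
    ({((i, j), (i, j')) | i j j'. i \<in> {1..k} \<and> 1 \<le> j \<and> j \<le> j' \<and> j' \<le> X i}
     \<union> {((i, 1), (i + 1, 1)) | i. 1 \<le> i \<and> i < k}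
     \<union> {((\<tau> i, X (\<tau> i)), (\<tau> (i + 1), X (\<tau> (i + 1)))) | i. 1 \<le> i \<and> i < k})\<^sup>+"

definition linear_extensions :: "'a set \<Rightarrow> 'a rel \<Rightarrow> 'a rel set" where
  "linear_extensions A r = {L. linear_order_on A L \<and> r \<subseteq> L}"

end

theory Submission
  imports Defs
begin

text \<open>
  Replace each position of a word \<open>v\<close> by the pair (letter, number of its occurrences so far). The
  resulting list determines \<open>v\<close>, and over all words with the letter counts of \<open>w\<close> these lists are
  exactly the enumerations of a fixed set in which the occurrences of each letter appear in order.
  Enumerations of a finite set are the same as linear orders on it, and naming letters by their
  first rank in \<open>w\<close> turns that set into the elements of the poset. The generating relations of the
  poset then say that occurrences of a letter are in order and that the first (last) occurrences
  come in the order prescribed by the first (last) rank function of \<open>w\<close>. One inclusion of orders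
  suffices for the latter, as both orders on letters are total.
\<close>

section \<open>Linear orders on a finite set as duplicate-free enumerations\<close>

definition list_order :: "'a list \<Rightarrow> 'a rel" where
  "list_order xs = {(xs ! p, xs ! q) | p q. p \<le> q \<and> q < length xs}"

lemma list_order_nth_iff:
  assumes "distinct xs" "p < length xs" "q < length xs"
  shows "(xs ! p, xs ! q) \<in> list_order xs \<longleftrightarrow> p \<le> q"
  using assms by (auto simp: list_order_def nth_eq_iff_index_eq)

text \<open>Serves to carry comparisons between occurrences over to poset elements along an
  injective relabelling.\<close>

lemma list_order_map:
  assumes "distinct xs" "inj_on f (set xs)" "a \<in> set xs" "b \<in> set xs"
  shows "(f a, f b) \<in> list_order (map f xs) \<longleftrightarrow> (a, b) \<in> list_order xs"
proof -
  obtain p q where pq: "p < length xs" "a = xs ! p" "q < length xs" "b = xs ! q"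
    using assms(3,4) by (metis in_set_conv_nth)
  moreover have "distinct (map f xs)"
    using assms(1,2) by (simp add: distinct_map)
  ultimately show ?thesis
    using list_order_nth_iff[of "map f xs" p q] list_order_nth_iff[of xs p q] assms(1) by simp
qed

lemma linear_order_list_order:
  assumes "distinct xs"
  shows "linear_order_on (set xs) (list_order xs)"
proof -
  have tot: "(a, b) \<in> list_order xs \<or> (b, a) \<in> list_order xs"
    if "a \<in> set xs" "b \<in> set xs" for a b
    using that assms by (metis in_set_conv_nth list_order_nth_iff linear)
  have "trans (list_order xs)"
  proof (rule transI)
    fix a b c assume ab: "(a, b) \<in> list_order xs" and bc: "(b, c) \<in> list_order xs"
    obtain p q where "a = xs ! p" "b = xs ! q" "p \<le> q" "q < length xs"
      using ab unfolding list_order_def by auto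
    moreover obtain q' r where "b = xs ! q'" "c = xs ! r" "q' \<le> r" "r < length xs"
      using bc unfolding list_order_def by auto
    ultimately have "p \<le> r" "a = xs ! p" "c = xs ! r" "r < length xs"
      using assms by (auto simp: nth_eq_iff_index_eq)
    then show "(a, c) \<in> list_order xs"
      unfolding list_order_def by blast
  qed
  moreover have "list_order xs \<subseteq> set xs \<times> set xs"
    by (auto simp: list_order_def)
  moreover have "antisym (list_order xs)"
  proof (rule antisymI)
    fix a b assume ab: "(a, b) \<in> list_order xs" and ba: "(b, a) \<in> list_order xs"
    then obtain p q where "a = xs ! p" "b = xs ! q" "p \<le> q" "q < length xs"
      unfolding list_order_def by auto
    with ba show "a = b"
      using list_order_nth_iff[OF assms, of q p] by simp
  qed
  ultimately show ?thesis
    using tot unfolding linear_order_on_def partial_order_on_def preorder_on_def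
    by (auto simp: refl_on_def total_on_def)
qed

text \<open>A new last entry lies above everything before it and above itself. This recursion drives
  the inductions from the right below.\<close>

lemma list_order_snoc:
  "list_order (xs @ [a]) = list_order xs \<union> insert a (set xs) \<times> {a}"
proof (intro equalityI subsetI)
  fix z assume "z \<in> list_order (xs @ [a])"
  then obtain p q where "z = ((xs @ [a]) ! p, (xs @ [a]) ! q)" "p \<le> q" "q < Suc (length xs)"
    unfolding list_order_def by auto
  then show "z \<in> list_order xs \<union> insert a (set xs) \<times> {a}"
    by (cases "q < length xs"; cases "p < length xs")
      (auto simp: list_order_def nth_append)
next
  fix z assume "z \<in> list_order xs \<union> insert a (set xs) \<times> {a}"
  then consider p q where "z = (xs ! p, xs ! q)" "p \<le> q" "q < length xs"
    | p where "z = (xs ! p, a)" "p < length xs" | "z = (a, a)"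
    unfolding list_order_def by (auto simp: in_set_conv_nth)
  then show "z \<in> list_order (xs @ [a])"
  proof cases
    case 1
    then have "z = ((xs @ [a]) ! p, (xs @ [a]) ! q) \<and> p \<le> q \<and> q < length (xs @ [a])"
      by (simp add: nth_append)
    then show ?thesis unfolding list_order_def by blast
  next
    case 2
    then have "z = ((xs @ [a]) ! p, (xs @ [a]) ! length xs) \<and> p \<le> length xs
        \<and> length xs < length (xs @ [a])"
      by (simp add: nth_append)
    then show ?thesis unfolding list_order_def by blast
  next
    case 3
    then have "z = ((xs @ [a]) ! length xs, (xs @ [a]) ! length xs) \<and> length xs \<le> length xs
        \<and> length xs < length (xs @ [a])"
      by simp
    then show ?thesis unfolding list_order_def by blast
  qed
qed

lemma list_order_subset: "list_order xs \<subseteq> set xs \<times> set xs"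
  by (auto simp: list_order_def)

text \<open>Each list puts its last entry above all others, so the last entries agree. Restricting
  the order to the remaining elements gives the order of the shortened list, and induction
  applies.\<close>

lemma list_order_inj:
  assumes "distinct xs" "distinct ys" "set xs = set ys" "list_order xs = list_order ys"
  shows "xs = ys"
  using assms
proof (induction xs arbitrary: ys rule: rev_induct)
  case Nil
  then show ?case by simp
next
  case (snoc a xs)
  then obtain zs b where ys: "ys = zs @ [b]"
    by (metis append_is_Nil_conv list.distinct(1) rev_exhaust set_empty)
  have "(a, b) \<in> list_order ys" "(b, a) \<in> list_order (xs @ [a])"
    using snoc.prems(3) by (auto simp: list_order_snoc ys)
  then have "(a, b) \<in> list_order (xs @ [a])"
    using snoc.prems(4) by simp
  then have ab: "a = b"
    using snoc.prems(1) list_order_subset[of xs] by (auto simp: list_order_snoc)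
  have sets: "set xs = set zs"
    using snoc.prems(1,2,3) ys ab by auto
  have "list_order xs = list_order (xs @ [a]) \<inter> set xs \<times> set xs"
    using snoc.prems(1) list_order_subset[of xs] by (auto simp: list_order_snoc)
  also have "\<dots> = list_order (zs @ [a]) \<inter> set zs \<times> set zs"
    using snoc.prems(4) sets ys ab by simp
  also have "\<dots> = list_order zs"
    using snoc.prems(2) list_order_subset[of zs] ys ab by (auto simp: list_order_snoc)
  finally show ?case
    using snoc.IH[of zs] snoc.prems(1,2) sets ys ab by simp
qed

text \<open>The enumeration sorts \<open>A\<close> by the size of the down-sets of its elements,
  which is the rank in \<open>L\<close>.\<close>

lemma ex_list_order:
  assumes "finite A" "linear_order_on A L"
  shows "\<exists>xs. distinct xs \<and> set xs = A \<and> list_order xs = L"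
proof -
  have sub: "L \<subseteq> A \<times> A" and refl: "\<And>a. a \<in> A \<Longrightarrow> (a, a) \<in> L" and tr: "trans L"
    and anti: "antisym L" and tot: "\<And>a b. a \<in> A \<Longrightarrow> b \<in> A \<Longrightarrow> (a, b) \<in> L \<or> (b, a) \<in> L"
    using assms(2)
    unfolding linear_order_on_def partial_order_on_def preorder_on_def refl_on_def total_on_def
    by metis+
  define f where "f a = card {b. (b, a) \<in> L}" for a
  have fin: "finite {b. (b, a) \<in> L}" for a
    by (rule finite_subset[OF _ assms(1)]) (use sub in auto)
  have le: "f a \<le> f b" if "(a, b) \<in> L" for a b
    unfolding f_def using that tr by (intro card_mono fin) (auto dest: transD)
  have less: "f a < f b" if "(a, b) \<in> L" "a \<noteq> b" for a b
    unfolding f_def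
  proof (rule psubset_card_mono[OF fin])
    \<comment> \<open>\<open>b\<close> is below itself but, by antisymmetry, not below
      \<open>a\<close>; this makes the inclusion of down-sets strict.\<close>
    have "b \<in> {c. (c, b) \<in> L} - {c. (c, a) \<in> L}"
      using that sub refl anti by (auto dest: antisymD)
    then show "{c. (c, a) \<in> L} \<subset> {c. (c, b) \<in> L}"
      using that tr by (auto dest: transD)
  qed
  have L_iff: "(a, b) \<in> L \<longleftrightarrow> f a \<le> f b" if "a \<in> A" "b \<in> A" for a b
    using le less tot[OF that] refl that by (metis leD)
  have inj: "inj_on f A"
    using less tot by (metis inj_onI less_irrefl)
  have "f ` A \<subseteq> {1..card A}"
  proof
    fix m assume "m \<in> f ` A"
    then obtain a where a: "a \<in> A" "m = f a" by auto
    have "{b. (b, a) \<in> L} \<subseteq> A" "{b. (b, a) \<in> L} \<noteq> {}"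
      using sub refl a by auto
    then show "m \<in> {1..card A}"
      using fin a assms(1) by (simp add: f_def card_mono Suc_le_eq card_gt_0_iff)
  qed
  \<comment> \<open>An injective map into a finite set of the same size is onto.\<close>
  then have bij: "bij_betw f A {1..card A}"
    using inj by (simp add: bij_betw_def card_image card_subset_eq)
  define g where "g = inv_into A f"
  have g: "g i \<in> A" "f (g i) = i" if "i \<in> {1..card A}" for i
    using that bij unfolding g_def
    by (auto simp: bij_betw_def f_inv_into_f intro: inv_into_into)
  define xs where "xs = map g [1..<Suc (card A)]"
  have len: "length xs = card A" by (simp add: xs_def)
  \<comment> \<open>Ranks start at 1 because each element counts itself, list positions at 0; hence
    the shift by \<open>Suc\<close>.\<close>
  have nth: "xs ! p = g (Suc p)" if "p < card A" for p
    using that by (simp add: xs_def del: upt_Suc)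
  have gbij: "bij_betw g {1..card A} A"
    unfolding g_def using bij by (rule bij_betw_inv_into)
  have set: "set xs = A"
    using gbij by (simp add: xs_def bij_betw_def atLeastLessThanSuc_atLeastAtMost del: upt_Suc)
  have dist: "distinct xs"
    using gbij by (simp add: xs_def distinct_map bij_betw_def
        atLeastLessThanSuc_atLeastAtMost del: upt_Suc)
  have "(a, b) \<in> list_order xs \<longleftrightarrow> (a, b) \<in> L" if ab: "a \<in> A" "b \<in> A" for a b
  proof -
    obtain p q where pq: "p < card A" "a = xs ! p" "q < card A" "b = xs ! q"
      using ab set len by (metis in_set_conv_nth)
    then have "f a = Suc p" "f b = Suc q"
      using nth g by auto
    then show ?thesis
      using L_iff[OF ab] list_order_nth_iff[OF dist, of p q] pq len by simp
  qed
  then have "list_order xs = L"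
    using sub list_order_subset[of xs] set by auto
  then show ?thesis
    using dist set by blast
qed

lemma bij_betw_list_order:
  assumes "finite A"
  shows "bij_betw list_order {xs. distinct xs \<and> set xs = A} {L. linear_order_on A L}"
  unfolding bij_betw_def
proof
  show "inj_on list_order {xs. distinct xs \<and> set xs = A}"
    by (rule inj_onI) (auto intro: list_order_inj)
  show "list_order ` {xs. distinct xs \<and> set xs = A} = {L. linear_order_on A L}"
    using ex_list_order[OF assms] linear_order_list_order by (fastforce simp: image_iff)
qed

lemma bij_betw_map_distinct:
  assumes "bij_betw f A B"
  shows "bij_betw (map f) {xs. distinct xs \<and> set xs = A} {ys. distinct ys \<and> set ys = B}"
proof (rule bij_betw_byWitness[where f' = "map (inv_into A f)"])
  have f: "inj_on f A" "f ` A = B" and g: "inj_on (inv_into A f) B" "inv_into A f ` B = A"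
    using assms bij_betw_inv_into[OF assms] by (auto simp: bij_betw_def)
  show "\<forall>xs\<in>{xs. distinct xs \<and> set xs = A}. map (inv_into A f) (map f xs) = xs"
    using f by (auto intro!: map_idI)
  show "\<forall>ys\<in>{ys. distinct ys \<and> set ys = B}. map f (map (inv_into A f) ys) = ys"
    using f by (auto intro!: map_idI simp: f_inv_into_f)
  show "map f ` {xs. distinct xs \<and> set xs = A} \<subseteq> {ys. distinct ys \<and> set ys = B}"
    using f by (auto simp: distinct_map)
  show "map (inv_into A f) ` {ys. distinct ys \<and> set ys = B} \<subseteq> {xs. distinct xs \<and> set xs = A}"
    using g by (auto simp: distinct_map)
qed

section \<open>Words as enumerations of numbered occurrences\<close>

definition occurrences :: "'a list \<Rightarrow> ('a \<times> nat) list" where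
  "occurrences v = map (\<lambda>p. (v ! p, count_list (take (Suc p) v) (v ! p))) [0..<length v]"

text \<open>Numbering from 1 matches the second coordinates in \<open>chain_elems\<close>; a letter
  of count 0 contributes no pair.\<close>

definition occurrence_set :: "('a \<Rightarrow> nat) \<Rightarrow> ('a \<times> nat) set" where
  "occurrence_set c = {(x, j). 1 \<le> j \<and> j \<le> c x}"

lemma occurrences_Nil [simp]: "occurrences [] = []"
  by (simp add: occurrences_def)

text \<open>The number of an occurrence depends only on the prefix ending there, so appending a
  letter leaves earlier entries unchanged.\<close>

lemma occurrences_snoc [simp]:
  "occurrences (v @ [x]) = occurrences v @ [(x, Suc (count_list v x))]"
  by (simp add: occurrences_def nth_append)

lemma length_occurrences [simp]: "length (occurrences v) = length v"
  by (simp add: occurrences_def)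

lemma nth_occurrences:
  "p < length v \<Longrightarrow> occurrences v ! p = (v ! p, count_list (take (Suc p) v) (v ! p))"
  by (simp add: occurrences_def)

lemma map_fst_occurrences [simp]: "map fst (occurrences v) = v"
  by (simp add: occurrences_def o_def map_nth)

lemma set_occurrences: "set (occurrences v) = occurrence_set (count_list v)"
  by (induction v rule: rev_induct) (auto simp: occurrence_set_def split: if_splits)

lemma distinct_occurrences: "distinct (occurrences v)"
  by (induction v rule: rev_induct) (auto simp: set_occurrences occurrence_set_def)

text \<open>The fibre over \<open>x\<close> is \<open>{1..c x}\<close>, whose cardinality gives back
  \<open>c x\<close>.\<close>

lemma occurrence_set_inj: "occurrence_set c = occurrence_set d \<Longrightarrow> c = d"
proof
  fix x assume eq: "occurrence_set c = occurrence_set d"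
  have "{j. (x, j) \<in> occurrence_set c} = {1..c x}" "{j. (x, j) \<in> occurrence_set d} = {1..d x}"
    by (auto simp: occurrence_set_def)
  then have "{1..c x} = {1..d x}"
    using eq by metis
  then show "c x = d x"
    by (metis card_atLeastAtMost diff_Suc_1)
qed

text \<open>An appended letter receives the highest number so far for that letter and stands last,
  so it respects the order.\<close>

lemma occurrences_ascending:
  assumes "1 \<le> j" "j \<le> j'" "j' \<le> count_list v x"
  shows "((x, j), (x, j')) \<in> list_order (occurrences v)"
  using assms
proof (induction v arbitrary: j j' rule: rev_induct)
  case (snoc y v)
  then show ?case
    by (auto simp: list_order_snoc set_occurrences occurrence_set_def le_Suc_eq
        split: if_splits)
qed simp

text \<open>An ascending enumeration is determined by its letters: its last entry must carry the
  full count of its letter. Removing that entry lowers this count by one, and the rest is again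
  ascending.\<close>

lemma occurrences_map_fst:
  assumes "distinct es" "set es = occurrence_set c"
    and "\<And>x j j'. 1 \<le> j \<Longrightarrow> j \<le> j' \<Longrightarrow> j' \<le> c x \<Longrightarrow> ((x, j), (x, j')) \<in> list_order es"
  shows "occurrences (map fst es) = es"
  using assms
proof (induction es arbitrary: c rule: rev_induct)
  case Nil
  then show ?case by simp
next
  case (snoc e es)
  obtain x j where e: "e = (x, j)" by force
  have j: "1 \<le> j" "j \<le> c x"
    using snoc.prems(2) e by (auto simp: occurrence_set_def)
  \<comment> \<open>The pair \<open>(x, c x)\<close> may not precede \<open>e\<close>, yet
    \<open>e\<close> is the last entry; so the two coincide.\<close>
  have "((x, j), (x, c x)) \<in> list_order (es @ [e])"
    using snoc.prems(3) j by simp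
  then have jc: "j = c x"
    using snoc.prems(1) list_order_subset[of es] e by (auto simp: list_order_snoc)
  define c' where "c' = c(x := c x - 1)"
  have "set es = occurrence_set c - {(x, c x)}"
    using snoc.prems(1,2) e jc by auto
  also have "\<dots> = occurrence_set c'"
    by (auto simp: occurrence_set_def c'_def split: if_splits)
  finally have set: "set es = occurrence_set c'" .
  have "((y, i), (y, i')) \<in> list_order es" if "1 \<le> i" "i \<le> i'" "i' \<le> c' y" for y i i'
  proof -
    have "((y, i), (y, i')) \<in> list_order (es @ [e])"
      using that by (intro snoc.prems(3)) (auto simp: c'_def split: if_splits)
    moreover have "(y, i') \<in> set es"
      using that set by (simp add: occurrence_set_def)
    ultimately show ?thesis
      using snoc.prems(1) by (auto simp: list_order_snoc)
  qed
  then have IH: "occurrences (map fst es) = es"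
    using snoc.IH set snoc.prems(1) by simp
  \<comment> \<open>The number that \<open>occurrences\<close> gives to the last letter is one more
    than its count in the shortened word, that is \<open>Suc (c x - 1)\<close>, which is
    \<open>c x\<close> because \<open>c x\<close> is positive.\<close>
  have "count_list (map fst es) = c'"
    using set_occurrences[of "map fst es"] IH set by (simp add: occurrence_set_inj)
  then show ?case
    using IH e jc j by (simp add: c'_def)
qed

text \<open>Forgetting the numbers is the inverse map; the letter counts of the resulting word are
  recovered from its set of occurrences.\<close>

lemma bij_betw_occurrences:
  "bij_betw occurrences {v. \<forall>x. count_list v x = c x}
     {es \<in> {es. distinct es \<and> set es = occurrence_set c}.
       \<forall>x j j'. 1 \<le> j \<longrightarrow> j \<le> j' \<longrightarrow> j' \<le> c x \<longrightarrow> ((x, j), (x, j')) \<in> list_order es}"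
    (is "bij_betw _ ?V ?E")
proof (rule bij_betw_byWitness[where f' = "map fst"])
  show "\<forall>v\<in>?V. map fst (occurrences v) = v" by simp
  show "\<forall>es\<in>?E. occurrences (map fst es) = es"
    by (auto intro: occurrences_map_fst)
  show "occurrences ` ?V \<subseteq> ?E"
    by (auto simp: distinct_occurrences set_occurrences occurrences_ascending occurrence_set_def)
  show "map fst ` ?E \<subseteq> ?V"
  proof (intro subsetI)
    fix v assume "v \<in> map fst ` ?E"
    then obtain es where es: "es \<in> ?E" "v = map fst es" by blast
    then have "occurrences v = es"
      by (auto intro: occurrences_map_fst)
    then have "occurrence_set (count_list v) = occurrence_set c"
      using es set_occurrences[of v] by simp
    then show "v \<in> ?V"
      by (auto dest: occurrence_set_inj)
  qed
qed

section \<open>First and last positions in terms of occurrences\<close>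

lemma first_pos_props:
  assumes "x \<in> set v"
  shows "first_pos v x < length v" "v ! first_pos v x = x" "x \<notin> set (take (first_pos v x) v)"
proof -
  have "\<exists>i. i < length v \<and> v ! i = x"
    using assms by (simp add: in_set_conv_nth)
  then have "first_pos v x < length v \<and> v ! first_pos v x = x"
    unfolding first_pos_def by (rule LeastI_ex)
  then show *: "first_pos v x < length v" "v ! first_pos v x = x" by auto
  show "x \<notin> set (take (first_pos v x) v)"
    using not_less_Least[of _ "\<lambda>i. i < length v \<and> v ! i = x"] *
    by (auto simp: first_pos_def[symmetric] in_set_conv_nth)
qed

lemma last_pos_props:
  assumes "x \<in> set v"
  shows "last_pos v x < length v" "v ! last_pos v x = x" "x \<notin> set (drop (Suc (last_pos v x)) v)"
proof -
  have ex: "\<exists>i. i < length v \<and> v ! i = x"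
    using assms by (simp add: in_set_conv_nth)
  \<comment> \<open>\<open>GREATEST\<close> needs a bounded predicate; positions are bounded by
    \<open>length v\<close>.\<close>
  then have "last_pos v x < length v \<and> v ! last_pos v x = x"
    unfolding last_pos_def by (rule GreatestI_ex_nat[where b = "length v"]) auto
  then show *: "last_pos v x < length v" "v ! last_pos v x = x" by auto
  have "i \<le> last_pos v x" if "i < length v" "v ! i = x" for i
    unfolding last_pos_def using that by (intro Greatest_le_nat[where b = "length v"]) auto
  then show "x \<notin> set (drop (Suc (last_pos v x)) v)"
    using * by (auto simp: in_set_conv_nth) (metis add_Suc less_diff_conv add.commute not_less_eq_eq le_add1)
qed

lemma occurrences_first_pos:
  assumes "x \<in> set v"
  shows "occurrences v ! first_pos v x = (x, 1)"
  using first_pos_props[OF assms] by (simp add: nth_occurrences take_Suc_conv_app_nth)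

text \<open>No occurrence of \<open>x\<close> lies beyond its last position, so the prefix ending
  there already contains all of them.\<close>

lemma occurrences_last_pos:
  assumes "x \<in> set v"
  shows "occurrences v ! last_pos v x = (x, count_list v x)"
proof -
  let ?n = "Suc (last_pos v x)"
  have "count_list v x = count_list (take ?n v) x + count_list (drop ?n v) x"
    by (metis append_take_drop_id count_list_append)
  then show ?thesis
    using last_pos_props[OF assms] by (simp add: nth_occurrences)
qed

text \<open>Turns comparison of positions into comparison of occurrences, the form in which the
  generators of the poset are stated.\<close>

lemma first_pos_le_iff:
  assumes "x \<in> set v" "y \<in> set v"
  shows "first_pos v x \<le> first_pos v y \<longleftrightarrow> ((x, 1), (y, 1)) \<in> list_order (occurrences v)"
  using list_order_nth_iff[OF distinct_occurrences, of "first_pos v x" v "first_pos v y"]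
    assms first_pos_props occurrences_first_pos by simp

lemma last_pos_le_iff:
  assumes "x \<in> set v" "y \<in> set v"
  shows "last_pos v x \<le> last_pos v y \<longleftrightarrow>
    ((x, count_list v x), (y, count_list v y)) \<in> list_order (occurrences v)"
  using list_order_nth_iff[OF distinct_occurrences, of "last_pos v x" v "last_pos v y"]
    assms last_pos_props occurrences_last_pos by simp

section \<open>Rank functions and their equality\<close>

lemma rank_le_iff:
  fixes f :: "'a \<Rightarrow> nat"
  assumes "finite S" "x \<in> S" "y \<in> S"
  shows "card {z \<in> S. f z \<le> f x} \<le> card {z \<in> S. f z \<le> f y} \<longleftrightarrow> f x \<le> f y"
proof
  assume "f x \<le> f y"
  then show "card {z \<in> S. f z \<le> f x} \<le> card {z \<in> S. f z \<le> f y}"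
    using assms(1) by (intro card_mono) auto
next
  assume le: "card {z \<in> S. f z \<le> f x} \<le> card {z \<in> S. f z \<le> f y}"
  show "f x \<le> f y"
  proof (rule ccontr)
    assume "\<not> f x \<le> f y"
    then have "{z \<in> S. f z \<le> f y} \<subset> {z \<in> S. f z \<le> f x}"
      using assms(2) by auto
    then show False
      using le assms(1) psubset_card_mono[of "{z \<in> S. f z \<le> f x}" "{z \<in> S. f z \<le> f y}"] by simp
  qed
qed

lemma rank_bij:
  fixes f :: "'a \<Rightarrow> nat"
  assumes "finite S" "inj_on f S"
  shows "bij_betw (\<lambda>x\<in>S. card {z \<in> S. f z \<le> f x}) S {1..card S}"
proof -
  let ?r = "\<lambda>x\<in>S. card {z \<in> S. f z \<le> f x}"
  have inj: "inj_on ?r S"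
  proof (rule inj_onI)
    fix x y assume xy: "x \<in> S" "y \<in> S" "?r x = ?r y"
    then have "f x = f y"
      using rank_le_iff[OF assms(1), of x y f] rank_le_iff[OF assms(1), of y x f] by simp
    then show "x = y"
      using assms(2) xy by (simp add: inj_on_eq_iff)
  qed
  moreover have "?r ` S \<subseteq> {1..card S}"
    using assms(1) by (auto intro!: card_mono simp: Suc_le_eq card_gt_0_iff)
  ultimately show ?thesis
    using assms(1) by (simp add: bij_betw_def card_image card_subset_eq)
qed

text \<open>If \<open>f y < f x\<close>, the implication for the swapped pair gives
  \<open>g y \<le> g x\<close>, and injectivity of \<open>g\<close> rules out
  \<open>g x \<le> g y\<close>. So one direction forces both orders to agree.\<close>

lemma rank_eq_iff:
  fixes f g :: "'a \<Rightarrow> nat"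
  assumes "finite S" "inj_on g S"
  shows "(\<lambda>x\<in>S. card {z \<in> S. f z \<le> f x}) = (\<lambda>x\<in>S. card {z \<in> S. g z \<le> g x}) \<longleftrightarrow>
    (\<forall>x\<in>S. \<forall>y\<in>S. f x \<le> f y \<longrightarrow> g x \<le> g y)"
    (is "?eq \<longleftrightarrow> ?mono")
proof
  assume ?eq
  then have "card {z \<in> S. f z \<le> f x} = card {z \<in> S. g z \<le> g x}" if "x \<in> S" for x
    using that by (metis (no_types, lifting) restrict_apply')
  then show ?mono
    using rank_le_iff[OF assms(1), of _ _ f] rank_le_iff[OF assms(1), of _ _ g] by simp
next
  assume mono: ?mono
  have "f x \<le> f y \<longleftrightarrow> g x \<le> g y" if xy: "x \<in> S" "y \<in> S" for x y
  proof (cases "f x \<le> f y")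
    case True
    then show ?thesis using mono xy by blast
  next
    case False
    then have "g y \<le> g x" "x \<noteq> y"
      using mono xy by auto
    then have "\<not> g x \<le> g y"
      using assms(2) xy by (metis inj_onD order_antisym)
    then show ?thesis using False by blast
  qed
  then have "{z \<in> S. f z \<le> f x} = {z \<in> S. g z \<le> g x}" if "x \<in> S" for x
    using that by auto
  then show ?eq
    by (auto simp: restrict_def)
qed

lemma inj_on_first_pos: "inj_on (first_pos v) (set v)"
  by (rule inj_onI) (metis first_pos_props(2))

lemma inj_on_last_pos: "inj_on (last_pos v) (set v)"
  by (rule inj_onI) (metis last_pos_props(2))

lemma first_rank_bij: "bij_betw (first_rank w) (set w) {1..card (set w)}"
  unfolding first_rank_def by (rule rank_bij) (simp_all add: inj_on_first_pos)

lemma last_rank_bij: "bij_betw (last_rank w) (set w) {1..card (set w)}"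
  unfolding last_rank_def by (rule rank_bij) (simp_all add: inj_on_last_pos)

lemma first_rank_eq_iff:
  assumes "\<And>x. count_list v x = count_list w x"
  shows "first_rank w = first_rank v \<longleftrightarrow> (\<forall>x\<in>set w. \<forall>y\<in>set w.
    first_rank w x \<le> first_rank w y \<longrightarrow> ((x, 1), (y, 1)) \<in> list_order (occurrences v))"
proof -
  have set: "set v = set w"
    using assms by (metis count_list_0_iff subsetI subset_antisym)
  have "first_rank w x \<le> first_rank w y \<longleftrightarrow> first_pos w x \<le> first_pos w y"
    if "x \<in> set w" "y \<in> set w" for x y
    using that rank_le_iff[of "set w" x y "first_pos w"] by (simp add: first_rank_def)
  moreover have "first_rank w = first_rank v \<longleftrightarrow>
      (\<forall>x\<in>set w. \<forall>y\<in>set w. first_pos w x \<le> first_pos w y \<longrightarrow> first_pos v x \<le> first_pos v y)"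
    \<comment> \<open>Equal counts give equal supports, so both rank functions become restrictions
      to the same set, as \<open>rank_eq_iff\<close> requires.\<close>
    unfolding first_rank_def set
    by (rule rank_eq_iff) (use inj_on_first_pos[of v] set in auto)
  ultimately show ?thesis
    using first_pos_le_iff[of _ v] set by simp
qed

lemma last_rank_eq_iff:
  assumes "\<And>x. count_list v x = count_list w x"
  shows "last_rank w = last_rank v \<longleftrightarrow> (\<forall>x\<in>set w. \<forall>y\<in>set w.
    last_rank w x \<le> last_rank w y \<longrightarrow>
    ((x, count_list w x), (y, count_list w y)) \<in> list_order (occurrences v))"
proof -
  have set: "set v = set w"
    using assms by (metis count_list_0_iff subsetI subset_antisym)
  have "last_rank w x \<le> last_rank w y \<longleftrightarrow> last_pos w x \<le> last_pos w y"
    if "x \<in> set w" "y \<in> set w" for x y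
    using that rank_le_iff[of "set w" x y "last_pos w"] by (simp add: last_rank_def)
  moreover have "last_rank w = last_rank v \<longleftrightarrow>
      (\<forall>x\<in>set w. \<forall>y\<in>set w. last_pos w x \<le> last_pos w y \<longrightarrow> last_pos v x \<le> last_pos v y)"
    unfolding last_rank_def set
    by (rule rank_eq_iff) (use inj_on_last_pos[of v] set in auto)
  ultimately show ?thesis
    using last_pos_le_iff[of _ v] set assms by simp
qed

text \<open>Induction along the ranks: reflexivity starts it and transitivity extends it by one
  step. It links the poset relations between neighbouring chains with comparisons of arbitrary
  letters.\<close>

lemma chain_iff_consecutive:
  fixes g :: "'a \<Rightarrow> nat"
  assumes "bij_betw g S {1..k}" "trans L" "\<And>x. x \<in> S \<Longrightarrow> (h x, h x) \<in> L"
  shows "(\<forall>x\<in>S. \<forall>y\<in>S. g x \<le> g y \<longrightarrow> (h x, h y) \<in> L) \<longleftrightarrow>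
    (\<forall>i. 1 \<le> i \<and> i < k \<longrightarrow> (h (inv_into S g i), h (inv_into S g (i + 1))) \<in> L)"
    (is "?all \<longleftrightarrow> ?consec")
proof -
  have g: "inj_on g S" "g ` S = {1..k}"
    using assms(1) by (auto simp: bij_betw_def)
  have inv: "inv_into S g i \<in> S" "g (inv_into S g i) = i" if "1 \<le> i" "i \<le> k" for i
    using that g(2) by (auto intro!: inv_into_into f_inv_into_f)
  show ?thesis
  proof
    assume ?all
    then show ?consec
      using inv by simp
  next
    assume consec: ?consec
    have le: "(h (inv_into S g i), h (inv_into S g j)) \<in> L" if "1 \<le> i" "i \<le> j" "j \<le> k" for i j
      using that(2,3)
    proof (induction j rule: dec_induct)
      case base
      then show ?case using assms(3) inv that(1) by simp
    next
      case (step j)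
      then have "(h (inv_into S g j), h (inv_into S g (j + 1))) \<in> L"
        using consec that(1) by simp
      then show ?case
        using step assms(2) by (auto dest: transD)
    qed
    show ?all
    proof (intro ballI impI)
      fix x y assume xy: "x \<in> S" "y \<in> S" "g x \<le> g y"
      then have "1 \<le> g x" "g y \<le> k"
        using g(2) by auto
      then show "(h x, h y) \<in> L"
        using le[of "g x" "g y"] xy g(1) by simp
    qed
  qed
qed

section \<open>The bijection with linear extensions\<close>

theorem proposition5p5:
  fixes w :: "nat list" and k :: nat and X \<tau> :: "nat \<Rightarrow> nat"
  assumes "w \<in> words"
    and "k = card (set w)"
    and "\<And>i. i \<in> {1..k} \<Longrightarrow> X i = count_list w (inv_into (set w) (first_rank w) i)"
    and "\<And>i. i \<in> {1..k} \<Longrightarrow> \<tau> i = first_rank w (inv_into (set w) (last_rank w) i)"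
  shows "\<exists>f. bij_betw f (mSt_class w) (linear_extensions (chain_elems k X) (chain_order k X \<tau>))"
proof -
  define S where "S = set w"
  define c where "c = count_list w"
  define r where "r = first_rank w"
  define l where "l = last_rank w"
  \<comment> \<open>The \<open>i\<close>-th chain belongs to the letter of first rank
    \<open>i\<close>, so a letter is renamed to its first rank and the occurrence number is
    kept.\<close>
  define \<phi> where "\<phi> = (\<lambda>(x, j :: nat). (r x, j))"
  \<comment> \<open>\<open>asc\<close> mirrors the relations inside chains and characterizes lists
    coming from words; \<open>ext\<close> mirrors those between least and between greatest elements
    and characterizes congruence to \<open>w\<close>.\<close>
  define asc where "asc L \<longleftrightarrow> (\<forall>x j j'. 1 \<le> j \<longrightarrow> j \<le> j' \<longrightarrow> j' \<le> c x \<longrightarrow> ((x, j), (x, j')) \<in> L)" for L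
  define ext where "ext L \<longleftrightarrow> (\<forall>x\<in>S. \<forall>y\<in>S. r x \<le> r y \<longrightarrow> ((x, 1), (y, 1)) \<in> L)
      \<and> (\<forall>x\<in>S. \<forall>y\<in>S. l x \<le> l y \<longrightarrow> ((x, c x), (y, c y)) \<in> L)" for L :: "(nat \<times> nat) rel"
  have r: "bij_betw r S {1..k}" and l: "bij_betw l S {1..k}"
    using first_rank_bij last_rank_bij assms(2) by (auto simp: r_def l_def S_def)
  have r_in: "r x \<in> {1..k}" and inv_r: "inv_into S r (r x) = x" if "x \<in> S" for x
    using that r by (auto simp: bij_betw_def)
  have inv_in: "inv_into S r i \<in> S" "r (inv_into S r i) = i" "inv_into S l i \<in> S" if "i \<in> {1..k}" for i
    using that r l by (auto simp: bij_betw_def intro!: inv_into_into f_inv_into_f)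
  have X: "X (r x) = c x" if "x \<in> S" for x
    using assms(3)[OF r_in[OF that]] inv_r[OF that] by (simp add: r_def c_def S_def)
  have \<tau>: "\<tau> i = r (inv_into S l i)" if "i \<in> {1..k}" for i
    using assms(4)[OF that] by (simp add: r_def l_def S_def)
  have c_pos: "1 \<le> c x \<longleftrightarrow> x \<in> S" for x
    using count_list_0_iff[of w x] by (auto simp: c_def S_def)
  have occ_S: "x \<in> S" if "(x, j) \<in> occurrence_set c" for x j
    using that c_pos[of x] by (auto simp: occurrence_set_def)
  have inj: "inj_on \<phi> (occurrence_set c)"
    using r occ_S by (auto simp: inj_on_def \<phi>_def bij_betw_def)
  have "\<phi> ` occurrence_set c = chain_elems k X"
  proof (intro equalityI subsetI)
    fix z assume "z \<in> \<phi> ` occurrence_set c"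
    then obtain x j where "z = (r x, j)" "(x, j) \<in> occurrence_set c"
      by (auto simp: \<phi>_def)
    then show "z \<in> chain_elems k X"
      using occ_S r_in X by (auto simp: chain_elems_def occurrence_set_def)
  next
    fix z assume "z \<in> chain_elems k X"
    then obtain i j where z: "z = (i, j)" "i \<in> {1..k}" "1 \<le> j" "j \<le> X i"
      by (auto simp: chain_elems_def)
    then have "(inv_into S r i, j) \<in> occurrence_set c"
      using X[of "inv_into S r i"] inv_in by (simp add: occurrence_set_def)
    moreover have "z = \<phi> (inv_into S r i, j)"
      using z inv_in by (simp add: \<phi>_def)
    ultimately show "z \<in> \<phi> ` occurrence_set c" by blast
  qed
  then have \<phi>: "bij_betw \<phi> (occurrence_set c) (chain_elems k X)"
    using inj by (simp add: bij_betw_def)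

  have "bij_betw occurrences {v \<in> {v. \<forall>x. count_list v x = c x}. mSt_cong w v}
     {es \<in> {es \<in> {es. distinct es \<and> set es = occurrence_set c}. asc (list_order es)}.
        ext (list_order es)}"
    unfolding asc_def
  proof (rule bij_betw_Collect[OF bij_betw_occurrences])
    fix v assume "v \<in> {v. \<forall>x. count_list v x = c x}"
    then have "count_list v x = count_list w x" for x
      by (simp add: c_def)
    then show "ext (list_order (occurrences v)) \<longleftrightarrow> mSt_cong w v"
      using first_rank_eq_iff[of v w] last_rank_eq_iff[of v w]
      by (simp add: mSt_cong_def ext_def r_def l_def c_def S_def)
  qed
  moreover have "{v \<in> {v. \<forall>x. count_list v x = c x}. mSt_cong w v} = mSt_class w"
  proof -
    \<comment> \<open>Equal counts give equal supports, so \<open>v\<close> uses only the positive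
      letters of \<open>w\<close>.\<close>
    have "v \<in> words" if "\<forall>x. count_list w x = count_list v x" for v
      using that assms(1) by (simp add: words_def lists_eq_set) (metis count_list_0_iff subset_iff)
    then show ?thesis
      by (auto simp: mSt_class_def mSt_cong_def c_def)
  qed
  ultimately have words: "bij_betw occurrences (mSt_class w)
     {es \<in> {es. distinct es \<and> set es = occurrence_set c}. asc (list_order es) \<and> ext (list_order es)}"
    by (simp add: conj_assoc)

  have "finite (chain_elems k X)"
    by (simp add: chain_elems_def)
  \<comment> \<open>This is a bijection between all enumerations and all linear orders; the
    conditions on the two sides are matched afterwards.\<close>
  then have "bij_betw (list_order \<circ> map \<phi>) {es. distinct es \<and> set es = occurrence_set c}
     {L. linear_order_on (chain_elems k X) L}"
    using bij_betw_map_distinct[OF \<phi>] bij_betw_list_order by (blast intro: bij_betw_trans)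
  then have "bij_betw (list_order \<circ> map \<phi>)
     {es \<in> {es. distinct es \<and> set es = occurrence_set c}. asc (list_order es) \<and> ext (list_order es)}
     {L \<in> {L. linear_order_on (chain_elems k X) L}. chain_order k X \<tau> \<subseteq> L}"
  proof (rule bij_betw_Collect)
    fix es assume "es \<in> {es. distinct es \<and> set es = occurrence_set c}"
    then have dist: "distinct es" and set: "set es = occurrence_set c" by auto
    define L where "L = list_order (map \<phi> es)"
    have L_iff: "(\<phi> a, \<phi> b) \<in> L \<longleftrightarrow> (a, b) \<in> list_order es"
      if "a \<in> occurrence_set c" "b \<in> occurrence_set c" for a b
      unfolding L_def using that list_order_map[OF dist] inj set by simp
    have "distinct (map \<phi> es)" "set (map \<phi> es) = chain_elems k X"
      using dist set \<phi> by (auto simp: distinct_map bij_betw_def)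
    then have "linear_order_on (chain_elems k X) L"
      using linear_order_list_order unfolding L_def by metis
    then have tr: "trans L" and refl: "\<And>a. a \<in> chain_elems k X \<Longrightarrow> (a, a) \<in> L"
      unfolding linear_order_on_def partial_order_on_def preorder_on_def refl_on_def by auto
    have refl': "(\<phi> a, \<phi> a) \<in> L" if "a \<in> occurrence_set c" for a
      using refl bij_betw_apply[OF \<phi> that] .
    \<comment> \<open>A letter of \<open>S\<close> occurs at least once, so its first and last
      occurrences are present (possibly equal).\<close>
    have mem: "(x, 1) \<in> occurrence_set c" "(x, c x) \<in> occurrence_set c" if "x \<in> S" for x
      using that c_pos by (auto simp: occurrence_set_def)
    have asc_iff: "{((i, j), (i, j')) | i j j'. i \<in> {1..k} \<and> 1 \<le> j \<and> j \<le> j' \<and> j' \<le> X i} \<subseteq> L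
        \<longleftrightarrow> asc (list_order es)" (is "?C \<subseteq> L \<longleftrightarrow> _")
    proof
      assume sub: "?C \<subseteq> L"
      show "asc (list_order es)"
        unfolding asc_def
      proof (intro allI impI)
        fix x j j' assume j: "1 \<le> j" "j \<le> j'" "j' \<le> c x"
        then have x: "x \<in> S" and occ: "(x, j) \<in> occurrence_set c" "(x, j') \<in> occurrence_set c"
          using c_pos[of x] by (auto simp: occurrence_set_def)
        have "((r x, j), (r x, j')) \<in> L"
          using j X[OF x] r_in[OF x] by (intro subsetD[OF sub]) simp
        then show "((x, j), (x, j')) \<in> list_order es"
          using L_iff[OF occ] by (simp add: \<phi>_def)
      qed
    next
      assume asc: "asc (list_order es)"
      show "?C \<subseteq> L"
      proof clarify
        fix i j j' assume i: "i \<in> {1..k}" and j: "1 \<le> j" "j \<le> j'" "j' \<le> X i"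
        define x where "x = inv_into S r i"
        have x: "x \<in> S" "r x = i" using inv_in[OF i] by (simp_all add: x_def)
        then have "X i = c x" using X[of x] by simp
        then have "((x, j), (x, j')) \<in> list_order es"
            "(x, j) \<in> occurrence_set c" "(x, j') \<in> occurrence_set c"
          using asc j by (auto simp: asc_def occurrence_set_def)
        then show "((i, j), (i, j')) \<in> L"
          using L_iff[of "(x, j)" "(x, j')"] x(2) by (simp add: \<phi>_def)
      qed
    qed
    have first_iff: "{((i, 1), (i + 1, 1)) | i. 1 \<le> i \<and> i < k} \<subseteq> L
        \<longleftrightarrow> (\<forall>x\<in>S. \<forall>y\<in>S. r x \<le> r y \<longrightarrow> ((x, 1), (y, 1)) \<in> list_order es)"
    proof -
      have "{((i, 1), (i + 1, 1)) | i. 1 \<le> i \<and> i < k} \<subseteq> L \<longleftrightarrow>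
          (\<forall>i. 1 \<le> i \<and> i < k \<longrightarrow> (\<phi> (inv_into S r i, 1), \<phi> (inv_into S r (i + 1), 1)) \<in> L)"
        using inv_in(2) by (auto simp: \<phi>_def)
      also have "\<dots> \<longleftrightarrow> (\<forall>x\<in>S. \<forall>y\<in>S. r x \<le> r y \<longrightarrow> (\<phi> (x, 1), \<phi> (y, 1)) \<in> L)"
        by (rule chain_iff_consecutive[OF r tr, symmetric]) (simp add: refl' mem(1)[simplified])
      finally show ?thesis
        using L_iff mem(1) by simp
    qed
    have last_iff: "{((\<tau> i, X (\<tau> i)), (\<tau> (i + 1), X (\<tau> (i + 1)))) | i. 1 \<le> i \<and> i < k} \<subseteq> L
        \<longleftrightarrow> (\<forall>x\<in>S. \<forall>y\<in>S. l x \<le> l y \<longrightarrow> ((x, c x), (y, c y)) \<in> list_order es)"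
    proof -
      \<comment> \<open>The greatest element of chain \<open>\<tau> i\<close> is the last occurrence
        of the letter of last rank \<open>i\<close>, renamed by \<open>\<phi>\<close>.\<close>
      have "(\<tau> i, X (\<tau> i)) = \<phi> (inv_into S l i, c (inv_into S l i))" if "i \<in> {1..k}" for i
        using \<tau>[OF that] X inv_in(3)[OF that] by (simp add: \<phi>_def)
      then have "{((\<tau> i, X (\<tau> i)), (\<tau> (i + 1), X (\<tau> (i + 1)))) | i. 1 \<le> i \<and> i < k} \<subseteq> L \<longleftrightarrow>
          (\<forall>i. 1 \<le> i \<and> i < k \<longrightarrow> (\<phi> (inv_into S l i, c (inv_into S l i)),
             \<phi> (inv_into S l (i + 1), c (inv_into S l (i + 1)))) \<in> L)"
        by auto
      also have "\<dots> \<longleftrightarrow> (\<forall>x\<in>S. \<forall>y\<in>S. l x \<le> l y \<longrightarrow> (\<phi> (x, c x), \<phi> (y, c y)) \<in> L)"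
        by (rule chain_iff_consecutive[OF l tr, symmetric]) (simp add: refl' mem(2))
      finally show ?thesis
        using L_iff mem(2) by simp
    qed
    \<comment> \<open>As \<open>L\<close> is transitive, containing the generated order amounts to
      containing its generators, which can then be treated one family at a time.\<close>
    have trancl: "R\<^sup>+ \<subseteq> L \<longleftrightarrow> R \<subseteq> L" for R
      using trancl_mono_subset[of R L] trancl_id[OF tr] by auto
    show "chain_order k X \<tau> \<subseteq> (list_order \<circ> map \<phi>) es \<longleftrightarrow>
        asc (list_order es) \<and> ext (list_order es)"
      unfolding chain_order_def o_apply L_def[symmetric] trancl Un_subset_iff
        asc_iff first_iff last_iff ext_def by blast
  qed
  then have "bij_betw (list_order \<circ> map \<phi>)
     {es \<in> {es. distinct es \<and> set es = occurrence_set c}. asc (list_order es) \<and> ext (list_order es)}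
     (linear_extensions (chain_elems k X) (chain_order k X \<tau>))"
    by (simp add: linear_extensions_def)
  with words show ?thesis
    by (blast intro: bij_betw_trans)
qed

end
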